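(* Let $\mathcal A$ be an algebra of subsets of $\mathcal G$ and $P:\mathcal A\to[0,\infty]$ a content with $P(\mathcal G)=1$ such that: (i) for every prime $p$ and every $M\subseteq\mathcal G_p$, the set $\pi_p^{-1}(M)$ lies in $\mathcal A$ and $P(\pi_p^{-1}(M))=P_p(M)$; (ii) for finitely many pairwise distinct primes $p_1,\dots,p_k$ and sets $M_i\subseteq\mathcal G_{p_i}$, $P\big(\bigcap_i\pi_{p_i}^{-1}(M_i)\big)=\prod_i P_{p_i}(M_i)$. Suppose that for every $n\ge1$ the set $\{G\in\mathcal G:\#G=n\}$ belongs to $\mathcal A$, or that for every $n\ge1$ the set $\{G\in\mathcal G:\exp(G)=n\}$ belongs to $\mathcal A$. Then there exist countably many pairwise disjoint sets in $\mathcal A$, each of content $0$, whose union is $\mathcal G$.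
   Context: All groups are finite abelian and considered up to isomorphism. $\mathcal G$ is the set of isomorphism classes of finite abelian groups, $\mathcal G_p$ the set of isomorphism classes of finite abelian $p$-groups, and $\pi_p:\mathcal G\to\mathcal G_p$ sends a group to its $p$-primary part. $\exp(G)$ is the least $n\ge1$ with $nG=0$. The local Cohen–Lenstra probability $P_p$ is the probability measure on the power set of $\mathcal G_p$ with $P_p(\{H\})=\frac{1}{\#\mathrm{Aut}(H)}\prod_{i\ge1}(1-p^{-i})$. A content on an algebra of sets $\mathcal A$ is a map $P:\mathcal A\to[0,\infty]$ with $P(\emptyset)=0$ and $P(A_1\cup A_2)=P(A_1)+P(A_2)$ for disjoint $A_1,A_2\in\mathcal A$. *)

theory Defs
  imports
    "HOL-Analysis.Analysis"
    "HOL-Computational_Algebra.Primes"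
    "HOL-Algebra.Coset"
    "HOL-Algebra.Bij"
begin

section \<open>Isomorphism classes of finite abelian groups\<close>

text \<open>
  Every finite group is isomorphic to one whose carrier consists of natural numbers
  (see \<open>ex_finite_abelian_group_iso\<close> below), so that the set of isomorphism classes of finite
  abelian groups is the quotient of the set of finite abelian groups of type \<open>nat monoid\<close>
  by the isomorphism relation.
\<close>

definition finite_abelian_groups :: "nat monoid set" where
  "finite_abelian_groups = {G. comm_group G \<and> finite (carrier G)}"

definition iso_rel :: "nat monoid rel" where
  "iso_rel = {(G, H). G \<in> finite_abelian_groups \<and> H \<in> finite_abelian_groups \<and> G \<cong> H}"

definition iso_classes :: "nat monoid set set" where
  "iso_classes = finite_abelian_groups // iso_rel"

definition primary_part :: "nat \<Rightarrow> ('a, 'b) monoid_scheme \<Rightarrow> ('a, 'b) monoid_scheme" where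
  "primary_part p G =
     G\<lparr>carrier := {x \<in> carrier G. \<exists>k::nat. x [^]\<^bsub>G\<^esub> (p ^ k) = \<one>\<^bsub>G\<^esub>}\<rparr>"

definition p_group :: "nat \<Rightarrow> ('a, 'b) monoid_scheme \<Rightarrow> bool" where
  "p_group p G \<longleftrightarrow> group G \<and> (\<forall>x\<in>carrier G. \<exists>k::nat. x [^]\<^bsub>G\<^esub> (p ^ k) = \<one>\<^bsub>G\<^esub>)"

definition p_iso_classes :: "nat \<Rightarrow> nat monoid set set" where
  "p_iso_classes p = {c \<in> iso_classes. \<exists>G\<in>c. p_group p G}"

text \<open>
  All groups in a class \<open>c\<close> have isomorphic \<open>p\<close>-primary parts, so this union is the single class
  of the \<open>p\<close>-primary part of any representative (\<open>primary_class_eq\<close> below).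
\<close>

definition primary_class :: "nat \<Rightarrow> nat monoid set \<Rightarrow> nat monoid set" where
  "primary_class p c = (\<Union>G\<in>c. iso_rel `` {primary_part p G})"

definition primary_preimage :: "nat \<Rightarrow> nat monoid set set \<Rightarrow> nat monoid set set" where
  "primary_preimage p M = {c \<in> iso_classes. primary_class p c \<in> M}"

definition group_exponent :: "('a, 'b) monoid_scheme \<Rightarrow> nat" where
  "group_exponent G = (LEAST n::nat. n \<ge> 1 \<and> (\<forall>x\<in>carrier G. x [^]\<^bsub>G\<^esub> n = \<one>\<^bsub>G\<^esub>))"

definition classes_of_order :: "nat \<Rightarrow> nat monoid set set" where
  "classes_of_order n = {c \<in> iso_classes. \<exists>G\<in>c. card (carrier G) = n}"

definition classes_of_exponent :: "nat \<Rightarrow> nat monoid set set" where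
  "classes_of_exponent n = {c \<in> iso_classes. \<exists>G\<in>c. group_exponent G = n}"


section \<open>The local Cohen--Lenstra probability\<close>

text \<open>The choice of the representative is immaterial by \<open>aut_card_eq\<close> below.\<close>

definition aut_card :: "nat monoid set \<Rightarrow> nat" where
  "aut_card c = card (auto (SOME G. G \<in> c))"

text \<open>
  The measure on the power set of the set of classes of finite abelian \<open>p\<close>-groups with the
  prescribed point masses.
\<close>

definition cohen_lenstra :: "nat \<Rightarrow> nat monoid set measure" where
  "cohen_lenstra p =
     point_measure (p_iso_classes p)
       (\<lambda>H. ennreal (1 / real (aut_card H) * (\<Prod>i. 1 - 1 / real p ^ Suc i)))"


section \<open>Contents\<close>

definition content_on :: "'a set set \<Rightarrow> ('a set \<Rightarrow> ennreal) \<Rightarrow> bool" where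
  "content_on \<A> P \<longleftrightarrow> P {} = 0 \<and>
     (\<forall>A\<^sub>1\<in>\<A>. \<forall>A\<^sub>2\<in>\<A>. A\<^sub>1 \<inter> A\<^sub>2 = {} \<longrightarrow> P (A\<^sub>1 \<union> A\<^sub>2) = P A\<^sub>1 + P A\<^sub>2)"


section \<open>Well-definedness\<close>

lemma equiv_iso_rel: "equiv finite_abelian_groups iso_rel"
proof (rule equivI)
  show "iso_rel \<subseteq> finite_abelian_groups \<times> finite_abelian_groups"
    by (auto simp: iso_rel_def)
  show "refl_on finite_abelian_groups iso_rel"
    by (auto simp: refl_on_def iso_rel_def)
  show "sym iso_rel"
    by (auto simp: sym_def iso_rel_def finite_abelian_groups_def comm_group_def
        intro: group.iso_sym)
  show "trans iso_rel"
    by (auto simp: trans_def iso_rel_def intro: iso_trans)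
qed

lemma ex_finite_abelian_group_iso:
  fixes G :: "('a, 'b) monoid_scheme"
  assumes "comm_group G" and "finite (carrier G)"
  shows "\<exists>H\<in>finite_abelian_groups. G \<cong> H"
proof -
  interpret comm_group G by fact
  obtain f :: "'a \<Rightarrow> nat" where f: "inj_on f (carrier G)"
    using assms(2) finite_imp_inj_to_nat_seg by blast
  define g where "g = inv_into (carrier G) f"
  have g: "g (f x) = x" if "x \<in> carrier G" for x
    using f that by (simp add: g_def)
  define H :: "nat monoid" where
    "H = \<lparr>carrier = f ` carrier G, mult = \<lambda>x y. f (g x \<otimes>\<^bsub>G\<^esub> g y), one = f \<one>\<^bsub>G\<^esub>\<rparr>"
  have "comm_group H"
  proof (rule comm_groupI)
    fix x assume "x \<in> carrier H"
    then obtain a where a: "a \<in> carrier G" "x = f a" by (auto simp: H_def)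
    then show "\<exists>y\<in>carrier H. y \<otimes>\<^bsub>H\<^esub> x = \<one>\<^bsub>H\<^esub>"
      by (intro bexI[of _ "f (inv\<^bsub>G\<^esub> a)"]) (auto simp: H_def g)
  qed (auto simp: H_def g m_ac)
  moreover have "f \<in> iso G H"
    using f by (auto simp: iso_iff hom_def H_def g)
  ultimately show ?thesis
    using assms(2) by (intro bexI[of _ H]) (auto simp: finite_abelian_groups_def H_def is_iso_def)
qed

lemma primary_part_pow:
  fixes n :: nat
  shows "x [^]\<^bsub>primary_part p G\<^esub> n = x [^]\<^bsub>G\<^esub> n"
  by (induction n) (auto simp: primary_part_def nat_pow_def)

lemma primary_part_one [simp]: "\<one>\<^bsub>primary_part p G\<^esub> = \<one>\<^bsub>G\<^esub>"
  and primary_part_mult [simp]: "x \<otimes>\<^bsub>primary_part p G\<^esub> y = x \<otimes>\<^bsub>G\<^esub> y"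
  by (simp_all add: primary_part_def)

lemma carrier_primary_part:
  "carrier (primary_part p G) = {x \<in> carrier G. \<exists>k::nat. x [^]\<^bsub>G\<^esub> (p ^ k) = \<one>\<^bsub>G\<^esub>}"
  by (simp add: primary_part_def)

lemma comm_group_primary_part:
  assumes "comm_group G"
  shows "comm_group (primary_part p G)"
proof -
  interpret comm_group G by fact
  show ?thesis
  proof (rule comm_groupI)
    fix x y assume x: "x \<in> carrier (primary_part p G)" and y: "y \<in> carrier (primary_part p G)"
    then obtain k l :: nat where
      *: "x \<in> carrier G" "y \<in> carrier G" "x [^]\<^bsub>G\<^esub> (p ^ k) = \<one>\<^bsub>G\<^esub>" "y [^]\<^bsub>G\<^esub> (p ^ l) = \<one>\<^bsub>G\<^esub>"
      by (auto simp: carrier_primary_part)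
    have "x [^]\<^bsub>G\<^esub> (p ^ (k + l)) = \<one>\<^bsub>G\<^esub>"
      using * by (simp add: power_add flip: nat_pow_pow)
    moreover have "y [^]\<^bsub>G\<^esub> (p ^ (k + l)) = \<one>\<^bsub>G\<^esub>"
      using * nat_pow_pow[of y "p ^ l" "p ^ k"] by (simp add: power_add mult.commute)
    ultimately have "(x \<otimes>\<^bsub>G\<^esub> y) [^]\<^bsub>G\<^esub> (p ^ (k + l)) = \<one>\<^bsub>G\<^esub>"
      using * by (simp add: nat_pow_distrib)
    then show "x \<otimes>\<^bsub>primary_part p G\<^esub> y \<in> carrier (primary_part p G)"
      using * unfolding carrier_primary_part by auto
  next
    fix x assume x: "x \<in> carrier (primary_part p G)"
    then obtain k :: nat where *: "x \<in> carrier G" "x [^]\<^bsub>G\<^esub> (p ^ k) = \<one>\<^bsub>G\<^esub>"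
      by (auto simp: carrier_primary_part)
    then have "inv\<^bsub>G\<^esub> x [^]\<^bsub>G\<^esub> (p ^ k) = \<one>\<^bsub>G\<^esub>"
      by (simp add: nat_pow_inv)
    then show "\<exists>y\<in>carrier (primary_part p G). y \<otimes>\<^bsub>primary_part p G\<^esub> x = \<one>\<^bsub>primary_part p G\<^esub>"
      using * by (intro bexI[of _ "inv\<^bsub>G\<^esub> x"]) (auto simp: carrier_primary_part)
  qed (auto simp: carrier_primary_part m_ac)
qed

lemma primary_part_in_finite_abelian_groups:
  "G \<in> finite_abelian_groups \<Longrightarrow> primary_part p G \<in> finite_abelian_groups"
  by (auto simp: finite_abelian_groups_def comm_group_primary_part carrier_primary_part)

lemma p_group_primary_part:
  "comm_group G \<Longrightarrow> p_group p (primary_part p G)"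
  using comm_group_primary_part[of G p]
  by (auto simp: p_group_def primary_part_pow carrier_primary_part comm_group_def)

lemma primary_part_iso:
  assumes "comm_group G" "comm_group H" "G \<cong> H"
  shows "primary_part p G \<cong> primary_part p H"
proof -
  interpret G: comm_group G by fact
  interpret H: comm_group H by fact
  obtain f where f: "f \<in> hom G H" "f ` carrier G = carrier H" "inj_on f (carrier G)"
    using assms(3) by (auto simp: is_iso_def iso_iff)
  interpret group_hom G H f
    using f(1) by unfold_locales
  have eq: "f x [^]\<^bsub>H\<^esub> n = \<one>\<^bsub>H\<^esub> \<longleftrightarrow> x [^]\<^bsub>G\<^esub> n = \<one>\<^bsub>G\<^esub>" if "x \<in> carrier G" for x and n :: nat
    using that f(3) by (metis G.nat_pow_closed G.one_closed hom_nat_pow hom_one inj_on_def)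
  have "f ` carrier (primary_part p G) = carrier (primary_part p H)"
  proof (intro equalityI subsetI)
    fix y assume "y \<in> carrier (primary_part p H)"
    then obtain k :: nat where y: "y \<in> carrier H" "y [^]\<^bsub>H\<^esub> (p ^ k) = \<one>\<^bsub>H\<^esub>"
      by (auto simp: carrier_primary_part)
    moreover from y f(2) obtain x where "x \<in> carrier G" "y = f x"
      by blast
    ultimately show "y \<in> f ` carrier (primary_part p G)"
      using eq by (auto simp: carrier_primary_part)
  qed (auto simp: carrier_primary_part eq)
  moreover have "f \<in> hom (primary_part p G) (primary_part p H)"
    using eq by (auto simp: hom_def carrier_primary_part)
  moreover have "inj_on f (carrier (primary_part p G))"
    using f(3) by (auto simp: carrier_primary_part inj_on_def)
  ultimately show ?thesis
    by (intro is_isoI[of f]) (simp add: iso_def bij_betw_def)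
qed

lemma primary_class_eq:
  assumes "c \<in> iso_classes" "G \<in> c"
  shows "primary_class p c = iso_rel `` {primary_part p G}"
proof -
  have "iso_rel `` {primary_part p H} = iso_rel `` {primary_part p G}" if "H \<in> c" for H
  proof (rule equiv_class_eq[OF equiv_iso_rel])
    have "(H, G) \<in> iso_rel"
      using assms that quotient_eq_iff[OF equiv_iso_rel, of c c H G]
      by (auto simp: iso_classes_def)
    then show "(primary_part p H, primary_part p G) \<in> iso_rel"
      using primary_part_in_finite_abelian_groups primary_part_iso
      by (auto simp: iso_rel_def finite_abelian_groups_def)
  qed
  then show ?thesis
    unfolding primary_class_def using assms(2) by (intro UN_constant_eq) blast+
qed

lemma primary_class_in_p_iso_classes:
  assumes "c \<in> iso_classes"
  shows "primary_class p c \<in> p_iso_classes p"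
proof -
  obtain G where G: "G \<in> finite_abelian_groups" "c = iso_rel `` {G}"
    using assms by (auto simp: iso_classes_def elim: quotientE)
  then have "G \<in> c"
    using equiv_class_self[OF equiv_iso_rel] by auto
  moreover have "primary_part p G \<in> iso_rel `` {primary_part p G}"
    using G equiv_class_self[OF equiv_iso_rel] primary_part_in_finite_abelian_groups by blast
  moreover have "iso_rel `` {primary_part p G} \<in> iso_classes"
    using G primary_part_in_finite_abelian_groups by (simp add: iso_classes_def quotientI)
  moreover have "p_group p (primary_part p G)"
    using G by (simp add: finite_abelian_groups_def p_group_primary_part)
  ultimately show ?thesis
    unfolding p_iso_classes_def primary_class_eq[OF assms \<open>G \<in> c\<close>] by blast
qed

lemma conj_in_auto:
  assumes a: "a \<in> auto L" and u: "u \<in> iso K L" and v: "v \<in> iso L K" and "group K"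
  shows "restrict (v \<circ> a \<circ> u) (carrier K) \<in> auto K"
proof -
  interpret K: group K by fact
  have "a \<in> iso L L"
    using a by (auto simp: auto_def Bij_def iso_def)
  then have "v \<circ> a \<circ> u \<in> iso K K"
    using iso_set_trans[OF iso_set_trans[OF u] v] by (simp only: comp_assoc)
  then have "v \<circ> a \<circ> u \<in> hom K K" "bij_betw (v \<circ> a \<circ> u) (carrier K) (carrier K)"
    by (simp_all only: iso_def mem_Collect_eq)
  then show ?thesis
    by (auto simp: auto_def Bij_def hom_def cong: bij_betw_cong)
qed

lemma card_auto_iso:
  assumes "group G" "group H" "G \<cong> H"
  shows "card (auto G) = card (auto H)"
proof -
  interpret G: group G by fact
  interpret H: group H by fact
  obtain f where f: "f \<in> iso G H"
    using assms(3) by (auto simp: is_iso_def)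
  define g where "g = inv_into (carrier G) f"
  have g: "g \<in> iso H G"
    using f G.iso_set_sym by (auto simp: g_def)
  have gf: "g (f x) = x" if "x \<in> carrier G" for x
    using f that by (simp add: g_def iso_iff)
  have fg: "f (g y) = y" if "y \<in> carrier H" for y
    using f that by (simp add: g_def iso_iff f_inv_into_f)
  have fc: "f x \<in> carrier H" if "x \<in> carrier G" for x
    using f that by (auto simp: iso_iff)
  have gc: "g x \<in> carrier G" if "x \<in> carrier H" for x
    using g that by (auto simp: iso_iff)
  have "bij_betw (\<lambda>a. restrict (f \<circ> a \<circ> g) (carrier H)) (auto G) (auto H)"
  proof (rule bij_betw_byWitness[where f' = "\<lambda>b. restrict (g \<circ> b \<circ> f) (carrier G)"])
    show "(\<lambda>a. restrict (f \<circ> a \<circ> g) (carrier H)) ` auto G \<subseteq> auto H"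
      using conj_in_auto f g assms by blast
    show "(\<lambda>b. restrict (g \<circ> b \<circ> f) (carrier G)) ` auto H \<subseteq> auto G"
      using conj_in_auto f g assms by blast
    show "\<forall>a\<in>auto G. restrict (g \<circ> restrict (f \<circ> a \<circ> g) (carrier H) \<circ> f) (carrier G) = a"
    proof
      fix a assume "a \<in> auto G"
      then have "a \<in> extensional (carrier G)" "\<And>x. x \<in> carrier G \<Longrightarrow> a x \<in> carrier G"
        by (auto simp: auto_def Bij_def hom_def)
      then show "restrict (g \<circ> restrict (f \<circ> a \<circ> g) (carrier H) \<circ> f) (carrier G) = a"
        by (intro extensionalityI[of _ "carrier G"]) (auto simp: gf fc)
    qed
    show "\<forall>b\<in>auto H. restrict (f \<circ> restrict (g \<circ> b \<circ> f) (carrier G) \<circ> g) (carrier H) = b"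
    proof
      fix b assume "b \<in> auto H"
      then have "b \<in> extensional (carrier H)" "\<And>x. x \<in> carrier H \<Longrightarrow> b x \<in> carrier H"
        by (auto simp: auto_def Bij_def hom_def)
      then show "restrict (f \<circ> restrict (g \<circ> b \<circ> f) (carrier G) \<circ> g) (carrier H) = b"
        by (intro extensionalityI[of _ "carrier H"]) (auto simp: fg gc)
    qed
  qed
  then show ?thesis
    by (rule bij_betw_same_card)
qed

lemma aut_card_eq:
  assumes "c \<in> iso_classes" "G \<in> c"
  shows "aut_card c = card (auto G)"
proof -
  have "(SOME G. G \<in> c) \<in> c"
    using assms(2) by (rule someI)
  then have "((SOME G. G \<in> c), G) \<in> iso_rel"
    using assms quotient_eq_iff[OF equiv_iso_rel, of c c "SOME G. G \<in> c" G]
    by (auto simp: iso_classes_def)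
  then show ?thesis
    unfolding aut_card_def
    by (intro card_auto_iso) (auto simp: iso_rel_def finite_abelian_groups_def comm_group_def)
qed

end

theory Submission
  imports
    Defs
    "HOL-Algebra.FiniteProduct"
begin

text \<open>
  A group of order or exponent \<open>n\<close> has trivial \<open>p\<close>-primary part for every prime \<open>p > n\<close>, and the
  trivial \<open>p\<close>-group has local probability at most \<open>1 - 1/p\<close>. By independence, the content of the
  groups of order (exponent) \<open>n\<close> is bounded by the product of \<open>1 - 1/p\<close> over any finite set of
  primes \<open>p > n\<close>. These products become arbitrarily small by Euler's argument, since the harmonic
  series diverges.
\<close>

section \<open>Euler products over large primes\<close>

text \<open>Expanding the geometric series in the product yields reciprocals of the numbers built
  from primes in \<open>S\<close>. The induction splits off one series by writing \<open>k\<close>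
  as \<open>p ^ j * m\<close> with \<open>m\<close> not divisible by \<open>p\<close>.\<close>

lemma sum_smooth_le_euler_product:
  fixes N :: nat
  assumes "finite S" and "\<And>p. p \<in> S \<Longrightarrow> prime p"
  shows "(\<Sum>k | k \<in> {1..N} \<and> prime_factors k \<subseteq> S. 1 / real k) \<le> (\<Prod>p\<in>S. 1 / (1 - 1 / real p))"
  using assms
proof (induction S rule: finite_induct)
  case empty
  \<comment> \<open>\<open>0\<close> has no prime factors either; the range \<open>{1..N}\<close>
    excludes it.\<close>
  have "{k. k \<in> {1..N} \<and> prime_factors k \<subseteq> {}} \<subseteq> {1}"
    by (auto simp: prime_factorization_empty_iff)
  then have "(\<Sum>k | k \<in> {1..N} \<and> prime_factors k \<subseteq> {}. 1 / real k) \<le> (\<Sum>k\<in>{1}. 1 / real k)"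
    by (intro sum_mono2) auto
  then show ?case by simp
next
  case (insert p S)
  define A where "A = {k. k \<in> {1..N} \<and> prime_factors k \<subseteq> S}"
  have p: "prime p" using insert.prems by simp
  then have p_gt: "1 < p" by (rule prime_gt_1_nat)
  have "(\<Sum>k | k \<in> {1..N} \<and> prime_factors k \<subseteq> insert p S. 1 / real k)
      \<le> (\<Sum>(j, m)\<in>{..<Suc N} \<times> A. (1 / real p) ^ j * (1 / real m))"
  \<comment> \<open>The map sends \<open>(j, m)\<close> back to \<open>k\<close>, so distinct
    \<open>k\<close> use distinct pairs; the remaining pairs contribute nonnegative terms.\<close>
  proof (rule sum_le_included[where i = "\<lambda>(j, m). p ^ j * m"])
    show "\<forall>k\<in>{k. k \<in> {1..N} \<and> prime_factors k \<subseteq> insert p S}.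
        \<exists>y\<in>{..<Suc N} \<times> A. (case y of (j, m) \<Rightarrow> p ^ j * m) = k \<and>
          1 / real k \<le> (case y of (j, m) \<Rightarrow> (1 / real p) ^ j * (1 / real m))"
    proof
      fix k assume k: "k \<in> {k. k \<in> {1..N} \<and> prime_factors k \<subseteq> insert p S}"
      have "k \<noteq> 0" "\<not> is_unit p" using k p by auto
      then obtain m where m: "k = p ^ multiplicity p k * m" "\<not> p dvd m"
        using multiplicity_decompose' by blast
      have "m \<noteq> 0" using m(1) \<open>k \<noteq> 0\<close> by (metis mult_0_right)
      have "m dvd k" using m(1) by (metis dvd_triv_right)
      then have "prime_factors m \<subseteq> prime_factors k"
        using \<open>k \<noteq> 0\<close> by (intro dvd_prime_factors)
      moreover have "p \<notin> prime_factors m" using m(2) by (auto simp: in_prime_factors_iff)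
      moreover have "m \<le> k" using \<open>m dvd k\<close> \<open>k \<noteq> 0\<close> by (simp add: dvd_imp_le)
      ultimately have "m \<in> A" using k \<open>m \<noteq> 0\<close> by (auto simp: A_def)
      \<comment> \<open>The crude estimate \<open>j < p ^ j \<le> k\<close> keeps the exponent
        within the truncation at \<open>N\<close>.\<close>
      have "multiplicity p k < p ^ multiplicity p k"
        using p_gt by (intro power_gt_expt) simp
      also have "\<dots> \<le> k"
        using \<open>k \<noteq> 0\<close> by (intro dvd_imp_le multiplicity_dvd) auto
      finally have "multiplicity p k < Suc N" using k by simp
      moreover have "1 / real k = (1 / real p) ^ multiplicity p k * (1 / real m)"
        by (subst m(1)) (simp add: power_one_over)
      ultimately show "\<exists>y\<in>{..<Suc N} \<times> A. (case y of (j, m) \<Rightarrow> p ^ j * m) = k \<and>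
          1 / real k \<le> (case y of (j, m) \<Rightarrow> (1 / real p) ^ j * (1 / real m))"
        using \<open>m \<in> A\<close> m(1) by (intro bexI[of _ "(multiplicity p k, m)"]) auto
    qed
  qed (auto simp: A_def)
  also have "\<dots> = (\<Sum>j<Suc N. (1 / real p) ^ j) * (\<Sum>m\<in>A. 1 / real m)"
    by (simp only: sum_product sum.cartesian_product)
  also have "\<dots> \<le> 1 / (1 - 1 / real p) * (\<Prod>p\<in>S. 1 / (1 - 1 / real p))"
  proof (rule mult_mono)
    have "(\<Sum>j<Suc N. (1 / real p) ^ j) \<le> (\<Sum>j. (1 / real p) ^ j)"
      using p_gt by (intro sum_le_suminf summable_geometric) auto
    also have "\<dots> = 1 / (1 - 1 / real p)"
      using p_gt by (intro suminf_geometric) auto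
    finally show "(\<Sum>j<Suc N. (1 / real p) ^ j) \<le> 1 / (1 - 1 / real p)" .
    show "(\<Sum>m\<in>A. 1 / real m) \<le> (\<Prod>p\<in>S. 1 / (1 - 1 / real p))"
      unfolding A_def using insert by simp
    show "0 \<le> 1 / (1 - 1 / real p)" using p_gt by simp
  qed (auto intro!: sum_nonneg)
  also have "\<dots> = (\<Prod>p\<in>insert p S. 1 / (1 - 1 / real p))"
    using insert by simp
  finally show ?case .
qed

text \<open>The product of \<open>1 / (1 - 1 / real p)\<close> over the primes up to
  \<open>N\<close> dominates \<open>harm N\<close>, which diverges. The primes up to
  \<open>n\<close> contribute only a fixed factor, so the primes beyond \<open>n\<close> must drive
  the product of \<open>1 - 1 / real p\<close> to \<open>0\<close>.\<close>

lemma prime_product_less: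
  fixes e :: real
  assumes "0 < e"
  shows "\<exists>S. finite S \<and> S \<noteq> {} \<and> (\<forall>p\<in>S. prime p \<and> n < p) \<and> (\<Prod>p\<in>S. 1 - 1 / real p) < e"
proof -
  define c where "c = (\<Prod>p | prime p \<and> p \<le> n. 1 - 1 / real p)"
  have pos: "0 < 1 - 1 / real p" if "prime p" for p
    using prime_gt_1_nat[OF that] by simp
  have "0 < c" unfolding c_def using pos by (intro prod_pos) blast
  \<comment> \<open>Requiring \<open>q \<le> N\<close> below makes \<open>S\<close> nonempty and
    gives \<open>n < N\<close>, so that \<open>T\<close> contains all primes up to
    \<open>n\<close>.\<close>
  obtain q where q: "prime q" "n < q" using bigger_prime by blast
  \<comment> \<open>This threshold turns \<open>harm N \<le> 1 / (c * x)\<close> into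
    \<open>x < e\<close>.\<close>
  have "eventually (\<lambda>N. 1 / (e * c) < (harm N :: real)) sequentially"
    using harm_at_top by (simp add: filterlim_at_top_dense)
  then have "eventually (\<lambda>N. 1 / (e * c) < (harm N :: real) \<and> q \<le> N) sequentially"
    using eventually_ge_at_top eventually_conj by blast
  then obtain N where N: "1 / (e * c) < (harm N :: real)" "q \<le> N"
    by (auto simp: eventually_sequentially)
  define S where "S = {p. prime p \<and> n < p \<and> p \<le> N}"
  define T where "T = {p. prime p \<and> p \<le> N}"
  define x where "x = (\<Prod>p\<in>S. 1 - 1 / real p)"
  have "0 < x" unfolding x_def S_def using pos by (intro prod_pos) blast
  have "finite T" by (rule finite_subset[of _ "{..N}"]) (auto simp: T_def)
  have T: "T = {p. prime p \<and> p \<le> n} \<union> S" using q N(2) by (auto simp: S_def T_def)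
  have "prime_factors k \<subseteq> T" if "k \<in> {1..N}" for k
  proof
    fix p assume "p \<in> prime_factors k"
    then have "prime p" "p \<le> k" using that by (auto simp: in_prime_factors_iff intro: dvd_imp_le)
    then show "p \<in> T" using that by (simp add: T_def)
  qed
  then have "{k. k \<in> {1..N} \<and> prime_factors k \<subseteq> T} = {1..N}"
    by blast
  moreover have "prime p" if "p \<in> T" for p
    using that by (simp add: T_def)
  ultimately have "harm N \<le> (\<Prod>p\<in>T. 1 / (1 - 1 / real p))"
    using sum_smooth_le_euler_product[OF \<open>finite T\<close>, of N]
    by (simp only: harm_def inverse_eq_divide)
  also have "\<dots> = 1 / (\<Prod>p\<in>T. 1 - 1 / real p)"
    by (simp add: prod_dividef)
  also have "(\<Prod>p\<in>T. 1 - 1 / real p) = c * x"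
    unfolding c_def x_def T using \<open>finite T\<close> T
    by (intro prod.union_disjoint) (auto simp: S_def)
  finally have "1 / (e * c) < 1 / (c * x)" using N(1) by simp
  then have "x < e"
    using \<open>0 < c\<close> \<open>0 < x\<close> \<open>0 < e\<close> by (simp add: field_simps)
  moreover have "finite S" "S \<noteq> {}"
    using \<open>finite T\<close> T q N(2) by (auto simp: S_def)
  ultimately show ?thesis
    unfolding x_def by (intro exI[of _ S]) (auto simp: S_def)
qed

section \<open>The trivial group\<close>

text \<open>The identity may be any natural number and the multiplication outside the carrier is
  arbitrary, so this single isomorphism class has many members. No prime enters, so it serves all
  \<open>p\<close> at once.\<close>

definition trivial_class :: "nat monoid set" where
  "trivial_class = {G \<in> finite_abelian_groups. carrier G = {\<one>\<^bsub>G\<^esub>}}"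

text \<open>Isomorphism preserves cardinality, and the constant map is an isomorphism between
  one-element groups.\<close>

lemma iso_rel_trivial:
  assumes "G \<in> trivial_class"
  shows "iso_rel `` {G} = trivial_class"
proof (intro equalityI subsetI)
  fix H assume "H \<in> iso_rel `` {G}"
  then have H: "H \<in> finite_abelian_groups" "G \<cong> H"
    by (auto simp: iso_rel_def)
  interpret H: comm_group H using H by (simp add: finite_abelian_groups_def)
  have "card (carrier H) = 1"
    using iso_same_card[OF H(2)] assms by (simp add: trivial_class_def)
  then have "carrier H = {\<one>\<^bsub>H\<^esub>}"
    using H.one_closed by (metis card_1_singletonE singletonD)
  then show "H \<in> trivial_class" using H by (simp add: trivial_class_def)
next
  fix H assume H: "H \<in> trivial_class"
  interpret G: comm_group G using assms by (simp add: trivial_class_def finite_abelian_groups_def)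
  interpret H: comm_group H using H by (simp add: trivial_class_def finite_abelian_groups_def)
  have "(\<lambda>_. \<one>\<^bsub>H\<^esub>) \<in> iso G H"
    using assms H by (auto simp: trivial_class_def iso_iff hom_def)
  then show "H \<in> iso_rel `` {G}"
    using assms H by (auto simp: iso_rel_def trivial_class_def is_iso_def)
qed

text \<open>Since \<open>n\<close> annihilates \<open>G\<close> and is coprime to
  \<open>p ^ k\<close>, only the identity is killed by a power of \<open>p\<close>. Assuming
  annihilation covers order and exponent together.\<close>

lemma primary_class_trivial:
  fixes n :: nat
  assumes c: "c \<in> iso_classes" "G \<in> c"
    and n: "1 \<le> n" "\<And>x. x \<in> carrier G \<Longrightarrow> x [^]\<^bsub>G\<^esub> n = \<one>\<^bsub>G\<^esub>"
    and p: "prime p" "n < p"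
  shows "primary_class p c = trivial_class"
proof -
  have G: "G \<in> finite_abelian_groups"
    using c by (auto simp: iso_classes_def iso_rel_def elim: quotientE)
  interpret G: comm_group G using G by (simp add: finite_abelian_groups_def)
  have "x = \<one>\<^bsub>G\<^esub>" if x: "x \<in> carrier G" "x [^]\<^bsub>G\<^esub> (p ^ k) = \<one>\<^bsub>G\<^esub>" for x and k :: nat
  proof -
    have "\<not> p dvd n" using n(1) p(2) by (auto dest: dvd_imp_le)
    then have "coprime (p ^ k) n" using p(1) by (simp add: prime_imp_coprime)
    \<comment> \<open>The subtraction-free Bezout identity keeps exponents natural: \<open>x\<close>
      equals its power to \<open>n * v + 1\<close>, which is its power to
      \<open>p ^ k * u\<close>.\<close>
    then obtain u v where uv: "p ^ k * u = n * v + 1"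
      using bezout_nat[of "p ^ k" n] p(1) by (auto simp: coprime_iff_gcd_eq_1)
    have "x = x [^]\<^bsub>G\<^esub> (n * v) \<otimes>\<^bsub>G\<^esub> x"
      using x n(2) by (simp flip: G.nat_pow_pow)
    also have "\<dots> = x [^]\<^bsub>G\<^esub> (p ^ k * u)"
      by (simp add: uv)
    also have "\<dots> = \<one>\<^bsub>G\<^esub>"
      using x by (simp flip: G.nat_pow_pow)
    finally show ?thesis .
  qed
  then have "carrier (primary_part p G) = {\<one>\<^bsub>G\<^esub>}"
    by (auto simp: carrier_primary_part)
  then have "primary_part p G \<in> trivial_class"
    using primary_part_in_finite_abelian_groups[OF G] by (simp add: trivial_class_def)
  then show ?thesis
    using primary_class_eq[OF c] iso_rel_trivial by simp
qed

text \<open>Every partial product is its first factor times factors in \<open>[0, 1]\<close>, and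
  the bound passes to the limit.\<close>

lemma prodinf_euler_le:
  assumes "1 < p"
  shows "(\<Prod>i. 1 - 1 / real p ^ Suc i) \<le> 1 - 1 / real p"
proof (rule LIMSEQ_le_const2)
  have less_1: "1 / real p ^ Suc i < 1" for i
    using assms one_less_power[of "real p" "Suc i"] by simp
  \<comment> \<open>Absolute summability and nonvanishing factors give convergence, which identifies
    the infinite product with the limit of its partial products.\<close>
  have "summable (\<lambda>i. \<bar>- (1 / real p ^ Suc i)\<bar>)"
    using summable_geometric[of "1 / real p"] assms summable_Suc_iff[of "\<lambda>i. (1 / real p) ^ i"]
    by (simp only: power_one_over abs_minus_cancel abs_divide abs_one power_abs abs_of_nat) simp
  moreover have "- (1 / real p ^ Suc i) \<noteq> -1" for i
    using less_1[of i] by linarith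
  ultimately have "convergent_prod (\<lambda>i. 1 + - (1 / real p ^ Suc i))"
    by (rule summable_imp_convergent_prod_real)
  then have "convergent_prod (\<lambda>i. 1 - 1 / real p ^ Suc i)"
    by (simp only: add_uminus_conv_diff)
  then show "(\<lambda>n. \<Prod>i\<le>n. 1 - 1 / real p ^ Suc i) \<longlonglongrightarrow> (\<Prod>i. 1 - 1 / real p ^ Suc i)"
    by (rule convergent_prod_LIMSEQ)
  have "(\<Prod>i\<le>n. 1 - 1 / real p ^ Suc i) \<le> 1 - 1 / real p" for n
  proof -
    have "(\<Prod>i\<le>n. 1 - 1 / real p ^ Suc i)
        = (1 - 1 / real p ^ Suc 0) * (\<Prod>i\<in>{..n} - {0}. 1 - 1 / real p ^ Suc i)"
      by (rule prod.remove) auto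
    also have "\<dots> \<le> (1 - 1 / real p ^ Suc 0) * 1"
    proof (intro mult_left_mono prod_le_1)
      show "0 \<le> 1 - 1 / real p ^ Suc 0" using less_1[of 0] by linarith
      show "0 \<le> 1 - 1 / real p ^ Suc i \<and> 1 - 1 / real p ^ Suc i \<le> 1" for i
        using less_1[of i] by simp
    qed
    finally show ?thesis by simp
  qed
  then show "\<exists>N. \<forall>n\<ge>N. (\<Prod>i\<le>n. 1 - 1 / real p ^ Suc i) \<le> 1 - 1 / real p"
    by blast
qed

text \<open>
  Only \<open>1 / real (aut_card c) \<le> 1\<close> is needed, which holds even for the junk value
  \<open>aut_card c = 0\<close>.
\<close>

lemma cohen_lenstra_singleton_le:
  assumes "prime p" "c \<in> p_iso_classes p"
  shows "emeasure (cohen_lenstra p) {c} \<le> ennreal (1 - 1 / real p)"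
proof -
  have p: "1 < p" using assms(1) by (rule prime_gt_1_nat)
  have "1 / real (aut_card c) * (\<Prod>i. 1 - 1 / real p ^ Suc i) \<le> 1 / real (aut_card c) * (1 - 1 / real p)"
    using prodinf_euler_le[OF p] by (intro mult_left_mono) auto
  also have "\<dots> \<le> 1 * (1 - 1 / real p)"
    using p by (intro mult_right_mono) (auto simp: divide_le_eq_1)
  finally show ?thesis
    using assms(2) by (simp add: cohen_lenstra_def emeasure_point_measure_finite2 ennreal_leI)
qed

section \<open>Null sets of a content\<close>

lemma content_mono:
  assumes "algebra \<Omega> \<A>" "content_on \<A> P" "A \<in> \<A>" "B \<in> \<A>" "A \<subseteq> B"
  shows "P A \<le> P B"
proof -
  interpret algebra \<Omega> \<A> by fact
  have "P (A \<union> (B - A)) = P A + P (B - A)"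
    using assms(2-4) Diff unfolding content_on_def by blast
  moreover have "A \<union> (B - A) = B" using assms(5) by auto
  ultimately show ?thesis by simp
qed

text \<open>Removing the earlier sets from \<open>F n\<close> takes finitely many operations, so the
  result stays in the algebra; being contained in \<open>F n\<close>, it is null by
  monotonicity.\<close>

lemma disjoint_null_cover:
  fixes F :: "nat \<Rightarrow> 'a set"
  assumes "algebra \<Omega> \<A>" "content_on \<A> P"
    and F: "\<And>n. F n \<in> \<A>" "\<And>n. P (F n) = 0" "(\<Union>n. F n) = \<Omega>"
  shows "\<exists>\<F>. countable \<F> \<and> \<F> \<subseteq> \<A> \<and> disjoint \<F> \<and> (\<forall>A\<in>\<F>. P A = 0) \<and> \<Union>\<F> = \<Omega>"
proof (intro exI conjI)
  interpret algebra \<Omega> \<A> by fact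
  show sub: "range (disjointed F) \<subseteq> \<A>"
    using F(1) by (intro range_disjointed_sets) auto
  show "disjoint (range (disjointed F))"
    by (intro disjoint_family_on_disjoint_image disjoint_family_disjointed)
  have "P (disjointed F n) \<le> P (F n)" for n
    using sub F(1) by (intro content_mono[OF assms(1,2)]) (auto simp: disjointed_subset)
  then show "\<forall>A\<in>range (disjointed F). P A = 0"
    using F(2) by simp
  show "\<Union> (range (disjointed F)) = \<Omega>"
    using F(3) by (simp add: UN_disjointed_eq)
qed simp

section \<open>Groups of bounded exponent\<close>

lemma class_memE:
  assumes "c \<in> iso_classes"
  obtains G where "G \<in> c" "comm_group G" "finite (carrier G)"
proof -
  obtain G where "G \<in> finite_abelian_groups" "c = iso_rel `` {G}"
    using assms by (auto simp: iso_classes_def elim: quotientE)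
  then show thesis
    using that equiv_class_self[OF equiv_iso_rel] by (auto simp: finite_abelian_groups_def)
qed

text \<open>The order of the group annihilates it, so the \<open>LEAST\<close> in the definition is
  taken over a nonempty set.\<close>

lemma group_exponent:
  assumes "comm_group G" "finite (carrier G)"
  shows "1 \<le> group_exponent G"
    and "x \<in> carrier G \<Longrightarrow> x [^]\<^bsub>G\<^esub> group_exponent G = \<one>\<^bsub>G\<^esub>"
proof -
  interpret comm_group G by fact
  have "1 \<le> card (carrier G) \<and> (\<forall>x\<in>carrier G. x [^]\<^bsub>G\<^esub> card (carrier G) = \<one>\<^bsub>G\<^esub>)"
    using assms(2) by (auto simp: power_order_eq_one card_gt_0_iff Suc_le_eq)
  then have "1 \<le> group_exponent G \<and> (\<forall>x\<in>carrier G. x [^]\<^bsub>G\<^esub> group_exponent G = \<one>\<^bsub>G\<^esub>)"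
    unfolding group_exponent_def by (rule LeastI)
  then show "1 \<le> group_exponent G"
    and "x \<in> carrier G \<Longrightarrow> x [^]\<^bsub>G\<^esub> group_exponent G = \<one>\<^bsub>G\<^esub>" by auto
qed

text \<open>The shift \<open>Suc n\<close> matches the range \<open>n \<ge> 1\<close> on which
  membership in the algebra is assumed; orders are positive because a carrier contains the
  identity.\<close>

lemma UN_classes_of_order: "(\<Union>n. classes_of_order (Suc n)) = iso_classes"
proof (intro equalityI subsetI)
  fix c assume c: "c \<in> iso_classes"
  then obtain G where G: "G \<in> c" "comm_group G" "finite (carrier G)" by (rule class_memE)
  interpret comm_group G by fact
  have "0 < card (carrier G)" using G(3) by (auto simp: card_gt_0_iff)
  then have "c \<in> classes_of_order (Suc (card (carrier G) - 1))"
    using c G(1) by (auto simp: classes_of_order_def)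
  then show "c \<in> (\<Union>n. classes_of_order (Suc n))" by blast
qed (auto simp: classes_of_order_def)

lemma UN_classes_of_exponent: "(\<Union>n. classes_of_exponent (Suc n)) = iso_classes"
proof (intro equalityI subsetI)
  fix c assume c: "c \<in> iso_classes"
  then obtain G where G: "G \<in> c" "comm_group G" "finite (carrier G)" by (rule class_memE)
  then have "1 \<le> group_exponent G"
    by (intro group_exponent)
  then have "c \<in> classes_of_exponent (Suc (group_exponent G - 1))"
    using c G(1) by (auto simp: classes_of_exponent_def)
  then show "c \<in> (\<Union>n. classes_of_exponent (Suc n))" by blast
qed (auto simp: classes_of_exponent_def)

lemma primary_class_of_order:
  assumes "1 \<le> n" "c \<in> classes_of_order n" "prime p" "n < p"
  shows "primary_class p c = trivial_class"
proof -
  obtain G where G: "c \<in> iso_classes" "G \<in> c" "card (carrier G) = n"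
    using assms(2) by (auto simp: classes_of_order_def)
  then have "comm_group G" "finite (carrier G)"
    by (auto simp: iso_classes_def iso_rel_def finite_abelian_groups_def elim: quotientE)
  then show ?thesis
    using G assms comm_group.power_order_eq_one[of G]
    by (intro primary_class_trivial[of c G n]) auto
qed

lemma primary_class_of_exponent:
  assumes "1 \<le> n" "c \<in> classes_of_exponent n" "prime p" "n < p"
  shows "primary_class p c = trivial_class"
proof -
  obtain G where G: "c \<in> iso_classes" "G \<in> c" "group_exponent G = n"
    using assms(2) by (auto simp: classes_of_exponent_def)
  then have "comm_group G" "finite (carrier G)"
    by (auto simp: iso_classes_def iso_rel_def finite_abelian_groups_def elim: quotientE)
  then show ?thesis
    using G assms group_exponent(2)[of G]
    by (intro primary_class_trivial[of c G n]) auto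
qed

theorem theorem2p5:
  fixes \<A> :: "nat monoid set set set"
    and P :: "nat monoid set set \<Rightarrow> ennreal"
  assumes alg: "algebra iso_classes \<A>"
    and content: "content_on \<A> P"
    and total: "P iso_classes = 1"
    and local: "\<And>p M. prime p \<Longrightarrow> M \<subseteq> p_iso_classes p \<Longrightarrow>
        primary_preimage p M \<in> \<A> \<and> P (primary_preimage p M) = emeasure (cohen_lenstra p) M"
    and indep: "\<And>S M. finite S \<Longrightarrow> S \<noteq> {} \<Longrightarrow> (\<And>p. p \<in> S \<Longrightarrow> prime p) \<Longrightarrow>
        (\<And>p. p \<in> S \<Longrightarrow> M p \<subseteq> p_iso_classes p) \<Longrightarrow>
        P (\<Inter>p\<in>S. primary_preimage p (M p)) = (\<Prod>p\<in>S. emeasure (cohen_lenstra p) (M p))"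
    and meas: "(\<forall>n\<ge>1. classes_of_order n \<in> \<A>) \<or> (\<forall>n\<ge>1. classes_of_exponent n \<in> \<A>)"
  shows "\<exists>\<F>. countable \<F> \<and> \<F> \<subseteq> \<A> \<and> disjoint \<F> \<and> (\<forall>A\<in>\<F>. P A = 0) \<and> \<Union>\<F> = iso_classes"
proof -
  \<comment> \<open>Stated for any \<open>A\<close> with trivial parts at all primes beyond
    \<open>n\<close>, so that both alternatives of \<open>meas\<close> are instances.\<close>
  have null: "P A = 0"
    if A: "A \<in> \<A>" "\<And>c p. c \<in> A \<Longrightarrow> prime p \<Longrightarrow> n < p \<Longrightarrow> primary_class p c = trivial_class"
    for A and n :: nat
  proof (cases "A = {}")
    case True
    then show ?thesis using content by (simp add: content_on_def)
  next
    case False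
    then obtain c where "c \<in> A" by blast
    interpret algebra iso_classes \<A> by fact
    have sub: "A \<subseteq> iso_classes" using A(1) sets_into_space by blast
    \<comment> \<open>A member of \<open>A\<close> witnesses that \<open>trivial_class\<close> is a
      class of \<open>p\<close>-groups, which \<open>local\<close> and \<open>indep\<close> require;
      hence the separate case of empty \<open>A\<close>.\<close>
    have triv: "trivial_class \<in> p_iso_classes p" if "prime p" "n < p" for p
      using A(2)[OF \<open>c \<in> A\<close> that] \<open>c \<in> A\<close> sub primary_class_in_p_iso_classes[of c p] by auto
    \<comment> \<open>The summand \<open>0\<close> fits the shape of
      \<open>ennreal_le_epsilon\<close>.\<close>
    have "P A \<le> 0 + ennreal e" if "0 < e" for e
    proof -
      obtain S where S: "finite S" "S \<noteq> {}" "\<And>p. p \<in> S \<Longrightarrow> prime p" "\<And>p. p \<in> S \<Longrightarrow> n < p"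
        and less: "(\<Prod>p\<in>S. 1 - 1 / real p) < e"
        using prime_product_less[OF \<open>0 < e\<close>, of n] by blast
      have "P A \<le> P (\<Inter>p\<in>S. primary_preimage p {trivial_class})"
      proof (rule content_mono[OF alg content A(1)])
        show "(\<Inter>p\<in>S. primary_preimage p {trivial_class}) \<in> \<A>"
          \<comment> \<open>An algebra is closed under finite nonempty intersections; here
            \<open>S \<noteq> {}\<close> enters.\<close>
          using S triv local by (intro finite_INT) auto
        show "A \<subseteq> (\<Inter>p\<in>S. primary_preimage p {trivial_class})"
          using A(2) S sub by (auto simp: primary_preimage_def)
      qed
      also have "\<dots> = (\<Prod>p\<in>S. emeasure (cohen_lenstra p) {trivial_class})"
        using S triv by (intro indep) auto
      also have "\<dots> \<le> (\<Prod>p\<in>S. ennreal (1 - 1 / real p))"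
        using S triv cohen_lenstra_singleton_le by (intro prod_mono_ennreal) auto
      also have "\<dots> = ennreal (\<Prod>p\<in>S. 1 - 1 / real p)"
      proof (rule prod_ennreal)
        show "0 \<le> 1 - 1 / real p" if "p \<in> S" for p
          using prime_gt_1_nat[OF S(3)[OF that]] by simp
      qed
      also have "\<dots> \<le> ennreal e"
        using less by (intro ennreal_leI) simp
      finally show ?thesis by simp
    qed
    then have "P A \<le> 0" by (rule ennreal_le_epsilon)
    then show ?thesis by simp
  qed
  from meas show ?thesis
  proof
    assume *: "\<forall>n\<ge>1. classes_of_order n \<in> \<A>"
    have "P (classes_of_order (Suc n)) = 0" for n
      using * primary_class_of_order[of "Suc n"] by (intro null[where n = "Suc n"]) simp_all
    then show ?thesis
      using * by (intro disjoint_null_cover[OF alg content _ _ UN_classes_of_order]) simp_all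
  next
    assume *: "\<forall>n\<ge>1. classes_of_exponent n \<in> \<A>"
    have "P (classes_of_exponent (Suc n)) = 0" for n
      using * primary_class_of_exponent[of "Suc n"] by (intro null[where n = "Suc n"]) simp_all
    then show ?thesis
      using * by (intro disjoint_null_cover[OF alg content _ _ UN_classes_of_exponent]) simp_all
  qed
qed

end
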